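(* Let $\Omega\subset\mathbb{R}^3$ be a bounded polyhedral domain, let $\mathcal{T}_h$ be a tetrahedral grid on $\Omega$ from a quasiuniform family, and let $\mathbf V_h$ be the enriched nonconforming $P_3$ space defined in the context. Then the bilinear form $(\nabla\mathbf u_h,\nabla\mathbf v_h)$ (with $\nabla$ taken tetrahedron by tetrahedron) is positive definite on the basis of $\mathbf V_h$; that is, if $$\mathbf v_h=\sum_{j=1}^{n_c}c_j\phi_j+\sum_{T\in\mathcal{T}_h}\sum_{i=1}^9 d_{T,i}\,\mathbf b_i^T,\qquad \Big(\sum_{j=1}^{n_c}c_j\phi_j\Big)\Big|_{\partial\Omega}=\mathbf 0,$$ satisfies $(\nabla\mathbf v_h,\nabla\mathbf v_h)=0$, then all coefficients vanish: $c_j=0$ for all $j$ and $d_{T,i}=0$ for all $T\in\mathcal{T}_h$ and $i=1,\dots,9$.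
   Context: Conventions. $\Omega\subset\mathbb{R}^3$ is a bounded (connected, open) polyhedral domain. $\mathcal{T}_h$ is a conforming (face-to-face) tetrahedral grid of $\overline\Omega$; the family of grids is quasiuniform in the usual sense (shape-regular, and all tetrahedra of $\mathcal{T}_h$ have diameter comparable to $h$). $P_k(T)$ is the space of polynomials of total degree at most $k$ on $T$. $(\cdot,\cdot)$ is the $L^2(\Omega)$ inner product; for piecewise polynomial functions $\nabla$ is computed on each tetrahedron separately, i.e. $(\nabla\mathbf u_h,\nabla\mathbf v_h)=\sum_{T\in\mathcal{T}_h}\int_T\nabla\mathbf u_h:\nabla\mathbf v_h\,d\mathbf x$. Reference bubble. Let $\hat T$ be the tetrahedron with vertices $\hat{\mathbf x}_0=(0,0,0)$, $\hat{\mathbf x}_1=(1,0,0)$, $\hat{\mathbf x}_2=(0,1,0)$, $\hat{\mathbf x}_3=(0,0,1)$, with coordinates $(x,y,z)$. Define $\hat{\mathbf b}=(\hat b_1,\hat b_2,\hat b_3)^T\in[P_4(\hat T)]^3$ by $$\begin{aligned}\hat b_1=&\tfrac{263}{12}x^4+38x^3y+\tfrac{265}{3}x^3z+29x^2y^2+96x^2yz+\tfrac{209}{2}x^2z^2-16xy^3+42xy^2z+42xyz^2+\tfrac{103}{3}xz^3\\&+\tfrac76y^4-y^2z^2-\tfrac{335}{12}z^4-\tfrac{253}{6}x^3-\tfrac{87}{2}x^2y-119x^2z+\tfrac{21}{2}xy^2-56xyz-65xz^2+\tfrac{112}{3}z^3\\&+\tfrac{703}{28}x^2+\tfrac72xy+\tfrac{251}{7}xz-\tfrac{41}{28}y^2+\tfrac27yz-\tfrac{169}{14}z^2-\tfrac{181}{42}x+\tfrac{13}{21}y+\tfrac{73}{840},\end{aligned}$$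 $$\begin{aligned}\hat b_2=&-\tfrac{233}{3}x^3y+\tfrac{67}{9}x^3z-\tfrac{233}{2}x^2y^2-235x^2yz+\tfrac{163}{6}x^2z^2-\tfrac{203}{3}xy^3-225xy^2z-209xyz^2+\tfrac{301}{9}xz^3\\&-\tfrac{64}{3}y^3z-21y^2z^2-\tfrac{16}{3}yz^3+\tfrac{113}{18}x^3+\tfrac{1105}{8}x^2y+\tfrac{155}{24}x^2z+\tfrac{1025}{8}xy^2+\tfrac{1077}{4}xyz-\tfrac{469}{24}xz^2\\&+\tfrac{79}{8}y^3+\tfrac{417}{8}y^2z+\tfrac{289}{8}yz^2-\tfrac{199}{72}z^3-\tfrac{625}{56}x^2-\tfrac{505}{7}xy-\tfrac{94}{7}xz-\tfrac{447}{28}y^2-\tfrac{251}{7}yz\\&+\tfrac{317}{56}x+\tfrac{625}{84}y+\tfrac{101}{42}z-\tfrac{383}{630},\end{aligned}$$ $$\begin{aligned}\hat b_3=&-10x^3y-10x^3z+x^2y^2+119x^2yz-15x^2z^2+16xy^3+145xy^2z+129xyz^2+16y^3z+11y^2z^2-\tfrac{29}{4}z^4\\&-\tfrac{93}{8}x^2y-\tfrac{61}{8}x^2z-\tfrac{301}{8}xy^2-\tfrac{693}{4}xyz-\tfrac{141}{8}xz^2-\tfrac{13}{4}y^3-\tfrac{321}{8}y^2z-\tfrac{193}{8}yz^2+\tfrac{77}{8}z^3\\&+\tfrac{181}{56}x^2+\tfrac{363}{14}xy+\tfrac{307}{14}xz+\tfrac{389}{56}y^2+\tfrac{199}{7}yz-\tfrac{563}{168}x-\tfrac{33}{8}y-\tfrac{263}{84}z+\tfrac{103}{210}.\end{aligned}$$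 This $\hat{\mathbf b}$ is chosen so that (i) $\int_{\hat F}\hat b_j\,q\,dF=0$ for each of the four faces $\hat F$ of $\hat T$, each $j=1,2,3$ and each $q\in P_2(\hat F)$, and (ii) $\operatorname{div}\hat{\mathbf b}=4x(x-y-z)\in P_2(\hat T)$. Bubbles on a general tetrahedron. For each $T\in\mathcal{T}_h$ fix an ordering $(\mathbf p_1,\mathbf p_2,\mathbf p_3,\mathbf p_4)$ of its vertices. For $i=1,\dots,9$ let $\mathbf F_i:\hat T\to T$ be the affine bijection sending $(\hat{\mathbf x}_0,\hat{\mathbf x}_1,\hat{\mathbf x}_2,\hat{\mathbf x}_3)$ to, respectively, $(\mathbf p_1,\mathbf p_2,\mathbf p_3,\mathbf p_4)$, $(\mathbf p_1,\mathbf p_3,\mathbf p_4,\mathbf p_2)$, $(\mathbf p_1,\mathbf p_4,\mathbf p_2,\mathbf p_3)$, $(\mathbf p_2,\mathbf p_3,\mathbf p_1,\mathbf p_4)$, $(\mathbf p_2,\mathbf p_1,\mathbf p_4,\mathbf p_3)$, $(\mathbf p_2,\mathbf p_4,\mathbf p_3,\mathbf p_1)$, $(\mathbf p_3,\mathbf p_1,\mathbf p_2,\mathbf p_4)$, $(\mathbf p_3,\mathbf p_4,\mathbf p_1,\mathbf p_2)$, $(\mathbf p_4,\mathbf p_1,\mathbf p_3,\mathbf p_2)$. With $J_i$ the (constant) Jacobian matrix of $\mathbf F_i$, set $\mathbf b_i^T(\mathbf x)=J_i\,\hat{\mathbf b}(\mathbf F_i^{-1}(\mathbf x))$ for $\mathbf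 x\in T$, extended by zero outside $T$. Space. Let $\{\phi_j\}_{j=1}^{n_c}$ be the vector Lagrange nodal basis of continuous piecewise $P_3$ vector fields on $\mathcal{T}_h$ (each scalar $P_3$ Lagrange nodal basis function times each of the three standard unit vectors). Then $$\mathbf V_h=\Big\{\mathbf v_h=\mathbf v_c+\mathbf v_b:\ \mathbf v_c=\sum_{j=1}^{n_c}c_j\phi_j,\ \mathbf v_c|_{\partial\Omega}=\mathbf 0,\ \mathbf v_b=\sum_{T\in\mathcal{T}_h}\sum_{i=1}^9 d_{T,i}\,\mathbf b_i^T,\ c_j,d_{T,i}\in\mathbb{R}\Big\}.$$ *)

theory Defs
  imports "HOL-Analysis.Analysis"
begin

text \<open>Bounded domains whose boundary is a finite union of plane polygons (a non-convex
  polygonal face is a union of convex ones).\<close>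

definition polyhedral_domain :: "(real^3) set \<Rightarrow> bool" where
  "polyhedral_domain \<Omega> \<longleftrightarrow>
     open \<Omega> \<and> connected \<Omega> \<and> bounded \<Omega> \<and> \<Omega> \<noteq> {} \<and>
     (\<exists>\<F>. finite \<F> \<and> (\<forall>F\<in>\<F>. polytope F \<and> aff_dim F = 2) \<and> frontier \<Omega> = \<Union>\<F>)"

text \<open>The library notion \<^const>\<open>triangulation\<close> already demands that any two
  members meet in a common face.\<close>

definition tetrahedral_grid :: "(real^3) set \<Rightarrow> (real^3) set set \<Rightarrow> bool" where
  "tetrahedral_grid \<Omega> \<T> \<longleftrightarrow>
     triangulation \<T> \<and> (\<forall>T\<in>\<T>. 3 simplex T) \<and> \<Union>\<T> = closure \<Omega>"

text \<open>A family of grids of one domain, indexed by mesh sizes \<open>h \<in> H\<close>.  The constants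
  \<open>\<sigma>\<close> (shape regularity: diameter against radius of an inscribed ball) and \<open>c\<^sub>0\<close>, \<open>c\<^sub>1\<close>
  (diameter against \<open>h\<close>) are the same for all grids.\<close>

definition quasiuniform_family ::
    "(real^3) set \<Rightarrow> real set \<Rightarrow> (real \<Rightarrow> (real^3) set set) \<Rightarrow> bool" where
  "quasiuniform_family \<Omega> H \<T> \<longleftrightarrow>
     (\<forall>h\<in>H. h > 0 \<and> tetrahedral_grid \<Omega> (\<T> h)) \<and>
     (\<exists>\<sigma>>0. \<forall>h\<in>H. \<forall>T\<in>\<T> h. \<exists>a r. r > 0 \<and> ball a r \<subseteq> T \<and> diameter T \<le> \<sigma> * r) \<and>
     (\<exists>c\<^sub>0>0. \<exists>c\<^sub>1>0. \<forall>h\<in>H. \<forall>T\<in>\<T> h. c\<^sub>0 * h \<le> diameter T \<and> diameter T \<le> c\<^sub>1 * h)"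

definition vertices :: "(real^3) set \<Rightarrow> (real^3) set" where
  "vertices T = {v. v extreme_point_of T}"

definition vertex_ordering :: "(real^3) set set \<Rightarrow> ((real^3) set \<Rightarrow> nat \<Rightarrow> real^3) \<Rightarrow> bool" where
  "vertex_ordering \<T> p \<longleftrightarrow> (\<forall>T\<in>\<T>. bij_betw (p T) {1..4} (vertices T))"

text \<open>\<open>f\<close> restricted to \<open>S\<close> belongs to \<open>P\<^sub>k(S)\<close>.\<close>

definition polynomial_of_degree_on :: "nat \<Rightarrow> (real^3) set \<Rightarrow> (real^3 \<Rightarrow> real) \<Rightarrow> bool" where
  "polynomial_of_degree_on k S f \<longleftrightarrow>
     (\<exists>c. \<forall>x\<in>S. f x = (\<Sum>(i, j, l) \<in> {(i, j, l). i + j + l \<le> k}.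
                        c i j l * (x$1)^i * (x$2)^j * (x$3)^l))"

text \<open>The \<open>P\<^sub>3\<close> Lagrange nodes of a tetrahedron: the points whose barycentric coordinates
  are multiples of \<open>1/3\<close>.\<close>

definition lagrange_nodes_of :: "(real^3) set \<Rightarrow> (real^3) set" where
  "lagrange_nodes_of T =
     {(\<Sum>v\<in>vertices T. (real (m v) / 3) *\<^sub>R v) | m :: real^3 \<Rightarrow> nat. (\<Sum>v\<in>vertices T. m v) = 3}"

definition lagrange_nodes :: "(real^3) set set \<Rightarrow> (real^3) set" where
  "lagrange_nodes \<T> = (\<Union>T\<in>\<T>. lagrange_nodes_of T)"

text \<open>\<open>\<phi> a\<close> is the nodal basis function of the node \<open>a\<close>.  These conditions determine it
  uniquely on \<open>\<Union>\<T>\<close>, the only place where its values are ever used.\<close>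

definition scalar_lagrange_basis ::
    "(real^3) set set \<Rightarrow> (real^3 \<Rightarrow> real^3 \<Rightarrow> real) \<Rightarrow> bool" where
  "scalar_lagrange_basis \<T> \<phi> \<longleftrightarrow>
     (\<forall>a\<in>lagrange_nodes \<T>.
        continuous_on (\<Union>\<T>) (\<phi> a) \<and>
        (\<forall>T\<in>\<T>. polynomial_of_degree_on 3 T (\<phi> a)) \<and>
        (\<forall>b\<in>lagrange_nodes \<T>. \<phi> a b = (if b = a then 1 else 0)))"

text \<open>The vector basis \<open>\<phi>\<^sub>j\<close> is indexed by pairs \<open>j = (a, k)\<close> of a node and a
  coordinate direction.\<close>

definition vector_lagrange :: "(real^3 \<Rightarrow> real^3 \<Rightarrow> real) \<Rightarrow> real^3 \<Rightarrow> 3 \<Rightarrow> real^3 \<Rightarrow> real^3" where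
  "vector_lagrange \<phi> a k x = \<phi> a x *\<^sub>R axis k 1"

definition ref_bubble_1 :: "real \<Rightarrow> real \<Rightarrow> real \<Rightarrow> real" where
  "ref_bubble_1 x y z =
      263/12 * x^4 + 38 * x^3 * y + 265/3 * x^3 * z + 29 * x^2 * y^2 + 96 * x^2 * y * z
           + 209/2 * x^2 * z^2 - 16 * x * y^3 + 42 * x * y^2 * z + 42 * x * y * z^2
           + 103/3 * x * z^3 + 7/6 * y^4 - y^2 * z^2 - 335/12 * z^4 - 253/6 * x^3
           - 87/2 * x^2 * y - 119 * x^2 * z + 21/2 * x * y^2 - 56 * x * y * z - 65 * x * z^2
           + 112/3 * z^3 + 703/28 * x^2 + 7/2 * x * y + 251/7 * x * z - 41/28 * y^2
           + 2/7 * y * z - 169/14 * z^2 - 181/42 * x + 13/21 * y + 73/840"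

definition ref_bubble_2 :: "real \<Rightarrow> real \<Rightarrow> real \<Rightarrow> real" where
  "ref_bubble_2 x y z =
      -233/3 * x^3 * y + 67/9 * x^3 * z - 233/2 * x^2 * y^2 - 235 * x^2 * y * z
           + 163/6 * x^2 * z^2 - 203/3 * x * y^3 - 225 * x * y^2 * z - 209 * x * y * z^2
           + 301/9 * x * z^3 - 64/3 * y^3 * z - 21 * y^2 * z^2 - 16/3 * y * z^3 + 113/18 * x^3
           + 1105/8 * x^2 * y + 155/24 * x^2 * z + 1025/8 * x * y^2 + 1077/4 * x * y * z
           - 469/24 * x * z^2 + 79/8 * y^3 + 417/8 * y^2 * z + 289/8 * y * z^2 - 199/72 * z^3
           - 625/56 * x^2 - 505/7 * x * y - 94/7 * x * z - 447/28 * y^2 - 251/7 * y * z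
           + 317/56 * x + 625/84 * y + 101/42 * z - 383/630"

definition ref_bubble_3 :: "real \<Rightarrow> real \<Rightarrow> real \<Rightarrow> real" where
  "ref_bubble_3 x y z =
      -10 * x^3 * y - 10 * x^3 * z + x^2 * y^2 + 119 * x^2 * y * z - 15 * x^2 * z^2
           + 16 * x * y^3 + 145 * x * y^2 * z + 129 * x * y * z^2 + 16 * y^3 * z
           + 11 * y^2 * z^2 - 29/4 * z^4 - 93/8 * x^2 * y - 61/8 * x^2 * z - 301/8 * x * y^2
           - 693/4 * x * y * z - 141/8 * x * z^2 - 13/4 * y^3 - 321/8 * y^2 * z
           - 193/8 * y * z^2 + 77/8 * z^3 + 181/56 * x^2 + 363/14 * x * y + 307/14 * x * z
           + 389/56 * y^2 + 199/7 * y * z - 563/168 * x - 33/8 * y - 263/84 * z + 103/210"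

definition ref_bubble :: "real^3 \<Rightarrow> real^3" where
  "ref_bubble x = vector [ref_bubble_1 (x$1) (x$2) (x$3),
                          ref_bubble_2 (x$1) (x$2) (x$3),
                          ref_bubble_3 (x$1) (x$2) (x$3)]"

text \<open>The affine map sending \<open>(0,0,0)\<close>, \<open>(1,0,0)\<close>, \<open>(0,1,0)\<close>, \<open>(0,0,1)\<close> to the four
  points of the list \<open>q\<close>, in this order.\<close>

definition ref_map :: "(real^3) list \<Rightarrow> real^3 \<Rightarrow> real^3" where
  "ref_map q x = q!0 + (x$1) *\<^sub>R (q!1 - q!0) + (x$2) *\<^sub>R (q!2 - q!0) + (x$3) *\<^sub>R (q!3 - q!0)"

definition bubble_orders :: "nat list list" where
  "bubble_orders =
     [[1,2,3,4], [1,3,4,2], [1,4,2,3],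
      [2,3,1,4], [2,1,4,3], [2,4,3,1],
      [3,1,2,4], [3,4,1,2], [4,1,3,2]]"

text \<open>The bubble \<open>b\<^sub>i\<^sup>T\<close> for \<open>i \<in> {1..9}\<close>.\<close>

definition bubble :: "((real^3) set \<Rightarrow> nat \<Rightarrow> real^3) \<Rightarrow> (real^3) set \<Rightarrow> nat \<Rightarrow> real^3 \<Rightarrow> real^3" where
  "bubble p T i x =
     (let F = ref_map (map (p T) (bubble_orders ! (i - 1))) in
      if x \<in> T then jacobian F (at (inv F x)) *v ref_bubble (inv F x) else 0)"

definition conforming_part ::
    "(real^3) set set \<Rightarrow> (real^3 \<Rightarrow> real^3 \<Rightarrow> real) \<Rightarrow> (real^3 \<Rightarrow> 3 \<Rightarrow> real) \<Rightarrow> real^3 \<Rightarrow> real^3" where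
  "conforming_part \<T> \<phi> c x =
     (\<Sum>a\<in>lagrange_nodes \<T>. \<Sum>k\<in>UNIV. c a k *\<^sub>R vector_lagrange \<phi> a k x)"

definition bubble_part ::
    "(real^3) set set \<Rightarrow> ((real^3) set \<Rightarrow> nat \<Rightarrow> real^3) \<Rightarrow> ((real^3) set \<Rightarrow> nat \<Rightarrow> real)
       \<Rightarrow> real^3 \<Rightarrow> real^3" where
  "bubble_part \<T> p d x = (\<Sum>T\<in>\<T>. \<Sum>i = 1..9. d T i *\<^sub>R bubble p T i x)"

text \<open>The gradient is taken tetrahedron by tetrahedron.  Fields in the enriched space jump
  across faces, so each integral is over the interior of \<open>T\<close>; the faces are null sets.  The
  inner product on \<open>real^3^3\<close> is the Frobenius product.\<close>

definition broken_grad_form ::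
    "(real^3) set set \<Rightarrow> (real^3 \<Rightarrow> real^3) \<Rightarrow> (real^3 \<Rightarrow> real^3) \<Rightarrow> real" where
  "broken_grad_form \<T> u v =
     (\<Sum>T\<in>\<T>. LINT x:interior T|lborel. jacobian u (at x) \<bullet> jacobian v (at x))"

end

theory Submission
  imports Defs
begin

text \<open>If the energy vanishes, the field is constant on every tetrahedron \<open>T\<close>.  On \<open>T\<close> it is a
  cubic field plus a combination of nine quartic bubbles, so its fourth difference along each edge
  of \<open>T\<close> is zero; the cubic part does not contribute to it.  The fourth differences of the bubbles
  along the edges are explicit, affinely invariant vectors, and the resulting linear system forces
  all nine bubble coefficients to vanish: the bubbles are linearly independent even modulo cubic
  fields, so no weak continuity across faces is needed.  The conforming part is then continuous and
  constant on every tetrahedron, hence constant on the connected set \<open>closure \<Omega>\<close>, and zero because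
  it vanishes on the nonempty boundary.\<close>

section \<open>Fourth differences\<close>

text \<open>The alternating binomial sum with step one quarter of the segment. For a polynomial in
  \<open>t\<close> along \<open>a + t (b - a)\<close> it kills degrees up to 3 and returns 4!/4^4 =
  3/32 times the coefficient of t^4 of a quartic.\<close>

definition fourth_difference :: "('a::real_vector \<Rightarrow> 'b::real_vector) \<Rightarrow> 'a \<Rightarrow> 'a \<Rightarrow> 'b" where
  "fourth_difference f a b =
     f a - 4 *\<^sub>R f ((3/4) *\<^sub>R a + (1/4) *\<^sub>R b) + 6 *\<^sub>R f ((1/2) *\<^sub>R a + (1/2) *\<^sub>R b)
       - 4 *\<^sub>R f ((1/4) *\<^sub>R a + (3/4) *\<^sub>R b) + f b"

lemma fourth_difference_add:
  "fourth_difference (\<lambda>x. f x + g x) a b = fourth_difference f a b + fourth_difference g a b"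
  by (simp add: fourth_difference_def algebra_simps)

lemma fourth_difference_scaleR:
  "fourth_difference (\<lambda>x. c *\<^sub>R f x) a b = c *\<^sub>R fourth_difference f a b"
  by (simp add: fourth_difference_def algebra_simps)

lemma fourth_difference_sum:
  "fourth_difference (\<lambda>x. \<Sum>i\<in>I. f i x) a b = (\<Sum>i\<in>I. fourth_difference (f i) a b)"
  by (simp add: fourth_difference_def sum.distrib sum_subtractf scaleR_sum_right)

lemma fourth_difference_commute: "fourth_difference f b a = fourth_difference f a b"
  by (simp add: fourth_difference_def algebra_simps)

lemma linear_fourth_difference:
  assumes "linear L"
  shows "L (fourth_difference f a b) = fourth_difference (\<lambda>x. L (f x)) a b"
  by (simp add: fourth_difference_def linear_add[OF assms] linear_diff[OF assms] linear_scale[OF assms])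

lemma fourth_difference_component:
  "fourth_difference f a b $ k = fourth_difference (\<lambda>x. f x $ k) a b"
  by (simp add: fourth_difference_def)

text \<open>Convexity keeps the five sample points inside \<open>S\<close>, and the weights 1, -4,
  6, -4, 1 add up to 0.\<close>

lemma fourth_difference_eq_0_if_constant:
  assumes "convex S" "a \<in> S" "b \<in> S" and const: "\<And>x. x \<in> S \<Longrightarrow> f x = C"
  shows "fourth_difference f a b = 0"
proof -
  have "f (u *\<^sub>R a + v *\<^sub>R b) = C" if "u \<ge> 0" "v \<ge> 0" "u + v = 1" for u v
    using assms that by (intro const convexD)
  then have "fourth_difference f a b = C - 4 *\<^sub>R C + 6 *\<^sub>R C - 4 *\<^sub>R C + C"
    using assms by (simp add: fourth_difference_def)
  also have "\<dots> = (1 - 4 + 6 - 4 + 1) *\<^sub>R C"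
    by (simp only: scaleR_add_left scaleR_diff_left scaleR_one)
  finally show ?thesis
    by simp
qed

text \<open>Along the line through \<open>a\<close> and \<open>b\<close> such a monomial is a
  univariate polynomial of degree at most 3. The proof checks the finitely many exponent triples by
  expansion.\<close>

lemma fourth_difference_monomial:
  fixes a b :: "real^3"
  assumes "i + j + l \<le> 3"
  shows "fourth_difference (\<lambda>x. (x$1)^i * (x$2)^j * (x$3)^l) a b = 0"
proof -
  have "i \<in> {0,1,2,3}" "j \<in> {0,1,2,3}" "l \<in> {0,1,2,3}"
    using assms by auto
  then show ?thesis
    using assms unfolding fourth_difference_def
    by (elim insertE emptyE; clarsimp; simp add: field_simps power2_eq_square power3_eq_cube)
qed

text \<open>\<open>polynomial_of_degree_on\<close> speaks of values on \<open>S\<close> only.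
  Passing to the polynomial on the whole space makes derivatives available and lets fourth
  differences vanish for arbitrary \<open>a\<close> and \<open>b\<close>.\<close>

lemma cubic_on_extend:
  assumes "polynomial_of_degree_on 3 S f"
  obtains g where "real_polynomial_function g" "\<And>x. x \<in> S \<Longrightarrow> f x = g x"
    "\<And>a b. fourth_difference g a b = 0"
proof -
  let ?I = "{(i::nat, j::nat, l::nat). i + j + l \<le> 3}"
  obtain c where c: "\<And>x. x \<in> S \<Longrightarrow>
      f x = (\<Sum>(i, j, l)\<in>?I. c i j l * (x$1)^i * (x$2)^j * (x$3)^l)"
    using assms unfolding polynomial_of_degree_on_def by blast
  define g where "g = (\<lambda>x::real^3. \<Sum>t\<in>?I. (case t of (i, j, l) \<Rightarrow> c i j l) *\<^sub>R
                        (case t of (i, j, l) \<Rightarrow> (x$1)^i * (x$2)^j * (x$3)^l))"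
  have "finite ?I"
    by (rule finite_subset[of _ "{..3} \<times> {..3} \<times> {..3}"]) auto
  then have "real_polynomial_function g"
    unfolding g_def
    by (intro real_polynomial_function_sum)
       (auto simp: split_beta bounded_linear_vec_nth intro!: real_polynomial_function.intros(2,4)
          real_polynomial_function_power real_polynomial_function.intros(1)[OF bounded_linear_vec_nth])
  moreover have "f x = g x" if "x \<in> S" for x
    using c[OF that] by (simp add: g_def split_beta mult.assoc)
  moreover have "fourth_difference g a b = 0" for a b
    unfolding g_def fourth_difference_sum fourth_difference_scaleR
    by (intro sum.neutral) (auto simp: fourth_difference_monomial)
  ultimately show ?thesis
    using that by blast
qed

lemma polynomial_of_degree_on_cmult:
  assumes "polynomial_of_degree_on k S f"
  shows "polynomial_of_degree_on k S (\<lambda>x. r * f x)"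
proof -
  obtain c where c: "\<forall>x\<in>S. f x = (\<Sum>(i, j, l) \<in> {(i, j, l). i + j + l \<le> k}.
                        c i j l * (x$1)^i * (x$2)^j * (x$3)^l)"
    using assms unfolding polynomial_of_degree_on_def by blast
  show ?thesis
    unfolding polynomial_of_degree_on_def
    by (rule exI[of _ "\<lambda>i j l. r * c i j l"])
       (simp add: c sum_distrib_left split_beta mult.assoc)
qed

lemma polynomial_of_degree_on_sum:
  assumes "\<And>a. a \<in> N \<Longrightarrow> polynomial_of_degree_on k S (f a)"
  shows "polynomial_of_degree_on k S (\<lambda>x. \<Sum>a\<in>N. f a x)"
proof -
  let ?I = "{(i::nat, j::nat, l::nat). i + j + l \<le> k}"
  let ?m = "\<lambda>(x::real^3) (i, j, l). (x$1)^i * (x$2)^j * (x$3)^l"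
  have poly: "polynomial_of_degree_on k S g \<longleftrightarrow>
      (\<exists>c. \<forall>x\<in>S. g x = (\<Sum>t\<in>?I. (case t of (i, j, l) \<Rightarrow> c i j l) * ?m x t))" for g
    by (simp add: polynomial_of_degree_on_def split_beta mult.assoc)
  have "\<forall>a\<in>N. \<exists>c. \<forall>x\<in>S. f a x = (\<Sum>t\<in>?I. (case t of (i, j, l) \<Rightarrow> c i j l) * ?m x t)"
    using assms unfolding poly by (rule ballI)
  then obtain c where c: "\<forall>a\<in>N. \<forall>x\<in>S.
      f a x = (\<Sum>t\<in>?I. (case t of (i, j, l) \<Rightarrow> c a i j l) * ?m x t)"
    by (rule bchoice[THEN exE])
  have "(\<Sum>a\<in>N. f a x) = (\<Sum>t\<in>?I. (case t of (i, j, l) \<Rightarrow> \<Sum>a\<in>N. c a i j l) * ?m x t)"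
    if "x \<in> S" for x
  proof -
    have "(\<Sum>a\<in>N. f a x) = (\<Sum>a\<in>N. \<Sum>t\<in>?I. (case t of (i, j, l) \<Rightarrow> c a i j l) * ?m x t)"
      using c that by (intro sum.cong refl) blast
    also have "\<dots> = (\<Sum>t\<in>?I. \<Sum>a\<in>N. (case t of (i, j, l) \<Rightarrow> c a i j l) * ?m x t)"
      by (rule sum.swap)
    also have "\<dots> = (\<Sum>t\<in>?I. (case t of (i, j, l) \<Rightarrow> \<Sum>a\<in>N. c a i j l) * ?m x t)"
      by (intro sum.cong refl) (simp add: sum_distrib_right split_beta)
    finally show ?thesis .
  qed
  then show ?thesis
    unfolding poly by (intro exI[of _ "\<lambda>i j l. \<Sum>a\<in>N. c a i j l"] ballI)
qed

section \<open>Polynomial fields of zero energy\<close>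

text \<open>The induction carries along that the derivative in each fixed direction depends
  continuously on the base point; this yields the continuity of the energy density.\<close>

lemma real_polynomial_function_has_derivative:
  fixes f :: "'a::real_normed_vector \<Rightarrow> real"
  assumes "real_polynomial_function f"
  obtains f' where "\<And>x. (f has_derivative f' x) (at x)" "\<And>u. continuous_on UNIV (\<lambda>x. f' x u)"
proof -
  have "\<exists>f'. (\<forall>x. (f has_derivative f' x) (at x)) \<and> (\<forall>u. continuous_on UNIV (\<lambda>x. f' x u))"
    using assms
  proof induction
    case (linear f)
    then show ?case
      by (intro exI[of _ "\<lambda>x. f"]) (auto intro: bounded_linear_imp_has_derivative)
  next
    case (const c)
    show ?case
      by (intro exI[of _ "\<lambda>x u. 0"]) auto
  next
    case (add f g)
    then obtain f' g' where
      "\<And>x. (f has_derivative f' x) (at x)" "\<And>u. continuous_on UNIV (\<lambda>x. f' x u)"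
      "\<And>x. (g has_derivative g' x) (at x)" "\<And>u. continuous_on UNIV (\<lambda>x. g' x u)"
      by blast
    then show ?case
      by (intro exI[of _ "\<lambda>x u. f' x u + g' x u"]) (auto intro!: has_derivative_add continuous_intros)
  next
    case (mult f g)
    then obtain f' g' where *:
      "\<And>x. (f has_derivative f' x) (at x)" "\<And>u. continuous_on UNIV (\<lambda>x. f' x u)"
      "\<And>x. (g has_derivative g' x) (at x)" "\<And>u. continuous_on UNIV (\<lambda>x. g' x u)"
      by blast
    have "continuous_on UNIV f" "continuous_on UNIV g"
      using * by (meson continuous_at_imp_continuous_on has_derivative_continuous)+
    with * show ?case
      by (intro exI[of _ "\<lambda>x u. f x * g' x u + f' x u * g x"])
         (auto intro!: has_derivative_mult continuous_intros)
  qed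
  then show ?thesis
    using that by blast
qed

lemma real_polynomial_function_component:
  "polynomial_function f \<Longrightarrow> real_polynomial_function (\<lambda>x. f x $ k)"
  unfolding polynomial_function_def using bounded_linear_vec_nth[of k] by (force simp: o_def)

lemma polynomial_function_componentI:
  fixes f :: "'a::real_normed_vector \<Rightarrow> real^'n"
  assumes "\<And>k. real_polynomial_function (\<lambda>x. f x $ k)"
  shows "polynomial_function f"
  unfolding polynomial_function_iff_Basis_inner
  using assms by (auto simp: Basis_vec_def inner_axis)

text \<open>Uniqueness of derivatives identifies row \<open>i\<close> of the Jacobian with the
  derivative of component \<open>i\<close>, whose continuous dependence on the point is
  known.\<close>

lemma continuous_on_jacobian_polynomial:
  fixes W :: "real^'n \<Rightarrow> real^'m"
  assumes "polynomial_function W"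
  shows "continuous_on UNIV (\<lambda>x. jacobian W (at x))"
proof -
  have "continuous_on UNIV (\<lambda>x. jacobian W (at x) $ i $ j)" for i j
  proof -
    have "real_polynomial_function (\<lambda>x. W x $ i)"
      using assms by (rule real_polynomial_function_component)
    then obtain f' where f': "\<And>x. ((\<lambda>x. W x $ i) has_derivative f' x) (at x)"
        "\<And>u. continuous_on UNIV (\<lambda>x. f' x u)"
      by (rule real_polynomial_function_has_derivative) blast
    have "jacobian W (at x) $ i $ j = f' x (axis j 1)" for x
    proof -
      have "(W has_derivative frechet_derivative W (at x)) (at x)"
        using differentiable_at_polynomial_function[OF assms] by (simp flip: frechet_derivative_works)
      then have "((\<lambda>x. W x $ i) has_derivative (\<lambda>u. frechet_derivative W (at x) u $ i)) (at x)"
        by (rule bounded_linear.has_derivative[OF bounded_linear_vec_nth])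
      then have "f' x = (\<lambda>u. frechet_derivative W (at x) u $ i)"
        using f'(1) has_derivative_unique by blast
      then show ?thesis
        by (simp add: jacobian_def matrix_def)
    qed
    then show ?thesis
      using f'(2) by simp
  qed
  then show ?thesis
    by (intro continuous_on_vec_lambda[where f = "\<lambda>i x. jacobian W (at x) $ i", simplified]
        continuous_on_vec_lambda[where f = "\<lambda>j x. jacobian W (at x) $ i $ j" for i, simplified])
qed

text \<open>Derivatives are local. This allows a discontinuous field to be replaced by a polynomial
  on the interior of one tetrahedron.\<close>

lemma jacobian_cong_open:
  fixes f g :: "real^'n \<Rightarrow> real^'m"
  assumes "open S" "x \<in> S" "\<And>y. y \<in> S \<Longrightarrow> f y = g y" "g differentiable (at x)"
  shows "jacobian f (at x) = jacobian g (at x)"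
proof -
  have "(g has_derivative frechet_derivative g (at x)) (at x)"
    using assms(4) by (simp add: frechet_derivative_works)
  then have "(f has_derivative frechet_derivative g (at x)) (at x)"
    by (rule has_derivative_transform_within_open[OF _ assms(1,2)]) (simp add: assms(3))
  then show ?thesis
    by (simp add: jacobian_def frechet_derivative_at[symmetric])
qed

text \<open>A continuous nonnegative density with zero integral vanishes throughout an open set; a
  zero derivative on the convex interior then makes \<open>W\<close> constant there.\<close>

lemma polynomial_constant_if_energy_0:
  fixes W :: "real^'n \<Rightarrow> real^'m"
  assumes W: "polynomial_function W"
    and S: "convex S" "compact S" "interior S \<noteq> {}"
    and energy: "(LINT x:interior S|lborel. jacobian W (at x) \<bullet> jacobian W (at x)) = 0"
  obtains C where "\<And>x. x \<in> S \<Longrightarrow> W x = C"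
proof -
  let ?g = "\<lambda>x. jacobian W (at x) \<bullet> jacobian W (at x)"
  have cont: "continuous_on UNIV ?g"
    by (intro continuous_intros continuous_on_jacobian_polynomial W)
  \<comment> \<open>A non-integrable function has integral 0 by convention, so \<open>energy\<close>
    is informative only once integrability is known. It comes from continuity on the compact set
    \<open>S\<close>.\<close>
  have "set_integrable lborel S ?g"
    unfolding set_integrable_def
    using borel_integrable_compact[OF S(2), of ?g] continuous_on_subset[OF cont] by simp
  then have int: "set_integrable lborel (interior S) ?g"
    by (rule set_integrable_subset) (auto simp: interior_subset)
  have "AE x in lborel. indicator (interior S) x *\<^sub>R ?g x = 0"
    using energy integral_nonneg_eq_0_iff_AE[OF int[unfolded set_integrable_def]]
    by (simp add: set_lebesgue_integral_def)
  then have "AE x in lborel. x \<notin> interior S \<inter> {x. ?g x \<noteq> 0}"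
    by eventually_elim (auto simp: indicator_def split: if_splits)
  \<comment> \<open>An open null set is empty, which turns the almost-everywhere statement into one
    about every interior point.\<close>
  moreover have op: "open (interior S \<inter> {x. ?g x \<noteq> 0})"
    by (intro open_Int open_interior open_Collect_neq cont continuous_on_const)
  ultimately have "interior S \<inter> {x. ?g x \<noteq> 0} \<in> null_sets lborel"
    using AE_iff_null_sets[of "interior S \<inter> {x. ?g x \<noteq> 0}" lborel] by (simp add: borel_open)
  then have "negligible (interior S \<inter> {x. ?g x \<noteq> 0})"
    unfolding negligible_iff_null_sets by (rule null_sets_completionI)
  then have "interior S \<inter> {x. ?g x \<noteq> 0} = {}"
    using op open_not_negligible by blast
  then have "jacobian W (at x) = 0" if "x \<in> interior S" for x
    using that by auto
  then have "(W has_derivative (\<lambda>u. 0)) (at x)" if "x \<in> interior S" for x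
    using that differentiable_at_polynomial_function[OF W, of x UNIV] by (simp add: jacobian_works)
  then obtain C where C: "\<And>x. x \<in> interior S \<Longrightarrow> W x = C"
    using has_derivative_zero_constant[of "interior S" W] S
    by (metis convex_interior has_derivative_at_withinI)
  \<comment> \<open>\<open>S\<close> lies in the closure of its interior, so continuity carries the
    value to the boundary, where vertices and edges lie.\<close>
  have "W x = C" if "x \<in> S" for x
  proof (rule continuous_constant_on_closure[of "interior S" W])
    show "continuous_on (closure (interior S)) W"
      by (intro continuous_on_polymonial_function W)
    show "x \<in> closure (interior S)"
      using that S convex_closure_interior closure_subset by blast
  qed (use C in auto)
  then show ?thesis
    using that by blast
qed

section \<open>Bubbles\<close>

definition ref_linear :: "(real^3) list \<Rightarrow> real^3 \<Rightarrow> real^3" where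
  "ref_linear q x = (x$1) *\<^sub>R (q!1 - q!0) + (x$2) *\<^sub>R (q!2 - q!0) + (x$3) *\<^sub>R (q!3 - q!0)"

lemma ref_map_eq: "ref_map q x = q!0 + ref_linear q x"
  by (simp add: ref_map_def ref_linear_def)

lemma linear_ref_linear: "linear (ref_linear q)"
  by (rule linearI) (simp_all add: ref_linear_def algebra_simps)

text \<open>The derivative of an affine map is its linear part at every point, so
  \<open>ref_linear q\<close> is the constant matrix J of the bubble.\<close>

lemma jacobian_ref_map: "jacobian (ref_map q) (at y) *v w = ref_linear q w"
proof -
  have "((\<lambda>x. q!0 + ref_linear q x) has_derivative ref_linear q) (at y)"
    by (auto intro!: derivative_eq_intros bounded_linear_imp_has_derivative
        simp: linear_ref_linear linear_conv_bounded_linear[symmetric])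
  then have "(ref_map q has_derivative ref_linear q) (at y)"
    by (simp add: ref_map_eq[abs_def])
  then have "frechet_derivative (ref_map q) (at y) = ref_linear q"
    by (metis frechet_derivative_at)
  then show ?thesis
    by (simp add: jacobian_def linear_ref_linear matrix_works)
qed

lemma inj_ref_linear:
  assumes "distinct [q0,q1,q2,q3]" "\<not> affine_dependent {q0,q1,q2,q3}"
  shows "inj (ref_linear [q0,q1,q2,q3])"
proof (subst linear_injective_0[OF linear_ref_linear], intro allI impI)
  fix x assume x: "ref_linear [q0,q1,q2,q3] x = 0"
  \<comment> \<open>The coordinates of \<open>x\<close>, balanced by minus their sum at
    \<open>q0\<close>, are the weights of an affine dependence of the four points.\<close>
  define u where "u = (\<lambda>q. if q = q1 then x$1 else if q = q2 then x$2 else if q = q3 then x$3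
                        else - x$1 - x$2 - x$3)"
  have "sum u {q0,q1,q2,q3} = 0" "(\<Sum>q\<in>{q0,q1,q2,q3}. u q *\<^sub>R q) = 0"
    using assms(1) x by (auto simp: u_def ref_linear_def algebra_simps)
  then have "\<forall>q\<in>{q0,q1,q2,q3}. u q = 0"
    using assms(2) by (auto simp: affine_dependent_explicit_finite)
  then have "u q1 = 0" "u q2 = 0" "u q3 = 0"
    by blast+
  then have "x$1 = 0" "x$2 = 0" "x$3 = 0"
    using assms(1) by (auto simp: u_def)
  then show "x = 0"
    by (simp add: vec_eq_iff forall_3)
qed

lemma bij_ref_map:
  assumes "distinct [q0,q1,q2,q3]" "\<not> affine_dependent {q0,q1,q2,q3}"
  shows "bij (ref_map [q0,q1,q2,q3])"
proof -
  have "bij (ref_linear [q0,q1,q2,q3])"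
    using inj_ref_linear[OF assms] linear_injective_imp_surjective[OF linear_ref_linear]
    by (auto simp: bij_def)
  then have "bij ((+) q0 \<circ> ref_linear [q0,q1,q2,q3])"
    by (intro bij_comp bij_plus)
  then show ?thesis
    by (simp add: ref_map_eq[abs_def] comp_def)
qed

text \<open>Equally spaced points of an edge are thereby pulled back to equally spaced points of a
  reference edge.\<close>

lemma inv_ref_map_affine:
  assumes "bij (ref_map q)" "u + v = 1"
  shows "inv (ref_map q) (u *\<^sub>R a + v *\<^sub>R b) = u *\<^sub>R inv (ref_map q) a + v *\<^sub>R inv (ref_map q) b"
proof -
  have *: "ref_map q (u *\<^sub>R s + v *\<^sub>R t) = u *\<^sub>R ref_map q s + v *\<^sub>R ref_map q t" for s t
  proof -
    have "q!0 = u *\<^sub>R q!0 + v *\<^sub>R q!0"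
      using assms(2) by (metis scaleR_add_left scaleR_one)
    then show ?thesis
      by (simp add: ref_map_eq linear_add[OF linear_ref_linear] linear_scale[OF linear_ref_linear]
          scaleR_add_right)
  qed
  show ?thesis
    by (metis * assms(1) bij_inv_eq_iff)
qed

lemma polynomial_function_inv_ref_map:
  assumes "bij (ref_map q)"
  shows "polynomial_function (inv (ref_map q))"
proof -
  have "inj (ref_linear q)"
    using assms by (auto simp: bij_def inj_def ref_map_eq)
  \<comment> \<open>The inverse of the affine map is affine: undo the translation by
    \<open>q!0\<close>, then apply a linear inverse \<open>g\<close> of the linear part.\<close>
  then obtain g where g: "linear g" "g \<circ> ref_linear q = id"
    using linear_injective_left_inverse[OF linear_ref_linear] by blast
  have "inv (ref_map q) x = g x - g (q!0)" for x
  proof -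
    have "g (ref_map q y) - g (q!0) = y" for y
      using g by (simp add: ref_map_eq linear_add pointfree_idE)
    then show ?thesis
      using assms by (metis bij_inv_eq_iff)
  qed
  then have "inv (ref_map q) = (\<lambda>x. g x - g (q!0))"
    by blast
  then show ?thesis
    using g by (simp add: polynomial_function_diff polynomial_function_bounded_linear
        linear_conv_bounded_linear)
qed

text \<open>The bubble of a tetrahedron as a polynomial field on the whole space, not cut off outside the
  tetrahedron.\<close>

definition mapped_bubble :: "(real^3) list \<Rightarrow> real^3 \<Rightarrow> real^3" where
  "mapped_bubble q x = ref_linear q (ref_bubble (inv (ref_map q) x))"

lemma polynomial_function_ref_bubble: "polynomial_function ref_bubble"
proof -
  have *: "real_polynomial_function (\<lambda>x::real^3. x$k)" for k
    by (simp add: real_polynomial_function.intros(1) bounded_linear_vec_nth)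
  have "real_polynomial_function (\<lambda>x. ref_bubble x $ 1)" "real_polynomial_function (\<lambda>x. ref_bubble x $ 2)"
      "real_polynomial_function (\<lambda>x. ref_bubble x $ 3)"
    unfolding ref_bubble_def vector_3 ref_bubble_1_def ref_bubble_2_def ref_bubble_3_def
    by (intro real_polynomial_function_diff real_polynomial_function.intros(2-4)
        real_polynomial_function_power *)+
  then show ?thesis
    by (intro polynomial_function_componentI) (metis exhaust_3)
qed

lemma polynomial_function_mapped_bubble:
  assumes "bij (ref_map q)"
  shows "polynomial_function (mapped_bubble q)"
proof -
  have "polynomial_function (ref_linear q \<circ> (ref_bubble \<circ> inv (ref_map q)))"
    by (intro polynomial_function_compose polynomial_function_inv_ref_map assms
        polynomial_function_ref_bubble polynomial_function_bounded_linear)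
       (simp add: linear_ref_linear flip: linear_conv_bounded_linear)
  then show ?thesis
    by (simp add: mapped_bubble_def[abs_def] comp_def)
qed

text \<open>The inner affine map matches the sample points and the outer linear map commutes with
  the difference, so one computation on the reference tetrahedron serves every tetrahedron.\<close>

lemma fourth_difference_mapped_bubble:
  assumes "bij (ref_map q)"
  shows "fourth_difference (mapped_bubble q) (ref_map q s) (ref_map q t) =
         ref_linear q (fourth_difference ref_bubble s t)"
proof -
  have "inv (ref_map q) (ref_map q s) = s" for s
    using assms by (simp add: bij_def)
  then show ?thesis
    by (simp add: linear_fourth_difference[OF linear_ref_linear])
       (simp add: fourth_difference_def mapped_bubble_def inv_ref_map_affine[OF assms])
qed

text \<open>Only the quartic terms survive. On the first edge, for instance, the term 263/12 x^4
  gives 263/12 * 3/32 = 263/128.\<close>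

lemma fourth_difference_ref_bubble:
  "fourth_difference ref_bubble 0 (axis 1 1) = vector [263/128, 0, 0]"
  "fourth_difference ref_bubble 0 (axis 2 1) = vector [7/64, 0, 0]"
  "fourth_difference ref_bubble 0 (axis 3 1) = vector [-335/128, 0, -87/128]"
  "fourth_difference ref_bubble (axis 1 1) (axis 2 1) = vector [361/128, 173/64, -15/32]"
  "fourth_difference ref_bubble (axis 1 1) (axis 3 1) = vector [-145/64, -247/192, -147/128]"
  "fourth_difference ref_bubble (axis 2 1) (axis 3 1) = vector [-333/128, 17/32, -147/128]"
  by (simp_all add: fourth_difference_def vec_eq_iff forall_3 axis_def ref_bubble_def ref_bubble_1_def
      ref_bubble_2_def ref_bubble_3_def field_simps)

lemma fourth_difference_mapped_bubble_edges:
  assumes "distinct [q0,q1,q2,q3]" "\<not> affine_dependent {q0,q1,q2,q3}"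
  defines "b \<equiv> mapped_bubble [q0,q1,q2,q3]"
  shows
    "fourth_difference b q0 q1 = (263/128) *\<^sub>R (q1 - q0)"
    "fourth_difference b q0 q2 = (7/64) *\<^sub>R (q1 - q0)"
    "fourth_difference b q0 q3 = (-335/128) *\<^sub>R (q1 - q0) + (-87/128) *\<^sub>R (q3 - q0)"
    "fourth_difference b q1 q2 =
       (361/128) *\<^sub>R (q1 - q0) + (173/64) *\<^sub>R (q2 - q0) + (-15/32) *\<^sub>R (q3 - q0)"
    "fourth_difference b q1 q3 =
       (-145/64) *\<^sub>R (q1 - q0) + (-247/192) *\<^sub>R (q2 - q0) + (-147/128) *\<^sub>R (q3 - q0)"
    "fourth_difference b q2 q3 =
       (-333/128) *\<^sub>R (q1 - q0) + (17/32) *\<^sub>R (q2 - q0) + (-147/128) *\<^sub>R (q3 - q0)"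
proof -
  let ?F = "ref_map [q0,q1,q2,q3]"
  have q: "?F 0 = q0" "?F (axis 1 1) = q1" "?F (axis 2 1) = q2" "?F (axis 3 1) = q3"
    by (simp_all add: ref_map_def axis_def)
  have "fourth_difference b (?F s) (?F t) = ref_linear [q0,q1,q2,q3] (fourth_difference ref_bubble s t)"
    for s t
    unfolding b_def using assms(1,2) by (intro fourth_difference_mapped_bubble bij_ref_map)
  note * = this[of 0 "axis 1 1"] this[of 0 "axis 2 1"] this[of 0 "axis 3 1"]
    this[of "axis 1 1" "axis 2 1"] this[of "axis 1 1" "axis 3 1"] this[of "axis 2 1" "axis 3 1"]
  show
    "fourth_difference b q0 q1 = (263/128) *\<^sub>R (q1 - q0)"
    "fourth_difference b q0 q2 = (7/64) *\<^sub>R (q1 - q0)"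
    "fourth_difference b q0 q3 = (-335/128) *\<^sub>R (q1 - q0) + (-87/128) *\<^sub>R (q3 - q0)"
    "fourth_difference b q1 q2 =
       (361/128) *\<^sub>R (q1 - q0) + (173/64) *\<^sub>R (q2 - q0) + (-15/32) *\<^sub>R (q3 - q0)"
    "fourth_difference b q1 q3 =
       (-145/64) *\<^sub>R (q1 - q0) + (-247/192) *\<^sub>R (q2 - q0) + (-147/128) *\<^sub>R (q3 - q0)"
    "fourth_difference b q2 q3 =
       (-333/128) *\<^sub>R (q1 - q0) + (17/32) *\<^sub>R (q2 - q0) + (-147/128) *\<^sub>R (q3 - q0)"
    using *[unfolded q] by (simp_all add: fourth_difference_ref_bubble ref_linear_def)
qed

text \<open>Nine of the eighteen equations that the three components of the fourth differences along
  the six edges of a tetrahedron impose on the bubble coefficients (scaled by \<open>32/3\<close>); these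
  nine already determine the coefficients.\<close>

lemma edge_system_nonsingular:
  fixes d1 d2 d3 d4 d5 d6 d7 d8 d9 :: real
  assumes
    "- 335/12 * d2 + 7/6 * d4 - 647/12 * d7 + 103/3 * d8 - 247/18 * d9 = 0"
    "7/6 * d3 - 335/12 * d6 - 5 * d7 - 111/4 * d8 + 1805/36 * d9 = 0"
    "7/6 * d1 - 647/12 * d4 + 1805/36 * d5 + 103/3 * d6 - 5 * d9 = 0"
    "- 335/12 * d3 - 5 * d4 - 247/18 * d5 - 111/4 * d6 + 7/6 * d8 - 647/12 * d9 = 0"
    "- 335/12 * d1 + 103/3 * d4 - 647/12 * d5 + 1805/36 * d6 - 247/18 * d7 - 5 * d8 = 0"
    "7/6 * d2 - 111/4 * d4 - 5 * d5 - 247/18 * d6 + 1805/36 * d7 - 647/12 * d8 = 0"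
    "- 5 * d1 - 247/18 * d2 - 111/4 * d3 + 7/6 * d6 - 335/12 * d8 + 103/3 * d9 = 0"
    "- 247/18 * d1 - 111/4 * d2 - 5 * d3 - 335/12 * d4 + 103/3 * d7 + 1805/36 * d8 = 0"
    "- 111/4 * d1 - 5 * d2 - 247/18 * d3 + 1805/36 * d4 + 103/3 * d5 - 647/12 * d6 = 0"
  shows "d1 = 0" "d2 = 0" "d3 = 0" "d4 = 0" "d5 = 0" "d6 = 0" "d7 = 0" "d8 = 0" "d9 = 0"
  using assms by algebra+

text \<open>On each edge \<open>f\<close> drops out of the fourth difference, leaving a vector
  equation in the \<open>d i\<close> alone. Coordinates along the edges at \<open>p 1\<close> remove
  the shape of the tetrahedron, so one fixed rational system remains.\<close>

lemma mapped_bubbles_independent_mod_cubics: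
  fixes p :: "nat \<Rightarrow> real^3" and d :: "nat \<Rightarrow> real"
  assumes p: "distinct [p 1, p 2, p 3, p 4]" "\<not> affine_dependent {p 1, p 2, p 3, p 4}"
    and S: "convex S" "p 1 \<in> S" "p 2 \<in> S" "p 3 \<in> S" "p 4 \<in> S"
    and f: "\<And>a b. fourth_difference f a b = 0"
    and const: "\<And>x. x \<in> S \<Longrightarrow>
      f x + (\<Sum>i=1..9. d i *\<^sub>R mapped_bubble (map p (bubble_orders ! (i - 1))) x) = C"
    and i: "i \<in> {1..9}"
  shows "d i = 0"
proof -
  define p1 p2 p3 p4 where pdefs: "p1 = p 1" "p2 = p 2" "p3 = p 3" "p4 = p 4"
  have dist: "distinct [p1, p2, p3, p4]" and ind: "\<not> affine_dependent {p1, p2, p3, p4}"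
    using p by (simp_all add: pdefs)
  have pS: "p1 \<in> S" "p2 \<in> S" "p3 \<in> S" "p4 \<in> S"
    using S by (simp_all add: pdefs)
  have 0: "(\<Sum>i=1..9. d i *\<^sub>R fourth_difference (mapped_bubble (map p (bubble_orders ! (i - 1)))) a b) = 0"
    if "a \<in> S" "b \<in> S" for a b
  proof -
    have "fourth_difference (\<lambda>x. f x +
        (\<Sum>i=1..9. d i *\<^sub>R mapped_bubble (map p (bubble_orders ! (i - 1))) x)) a b = 0"
      using S(1) that const by (rule fourth_difference_eq_0_if_constant)
    then show ?thesis
      by (simp only: fourth_difference_add f fourth_difference_sum fourth_difference_scaleR add_0)
  qed
  have sum9: "(\<Sum>i=1..9. g i) = g 1 + g 2 + g 3 + g 4 + g 5 + g 6 + g 7 + g 8 + g 9"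
    for g :: "nat \<Rightarrow> real^3"
    by (simp add: eval_nat_numeral)
  have 1: "d 1 *\<^sub>R fourth_difference (mapped_bubble [p1, p2, p3, p4]) a b
      + d 2 *\<^sub>R fourth_difference (mapped_bubble [p1, p3, p4, p2]) a b
      + d 3 *\<^sub>R fourth_difference (mapped_bubble [p1, p4, p2, p3]) a b
      + d 4 *\<^sub>R fourth_difference (mapped_bubble [p2, p3, p1, p4]) a b
      + d 5 *\<^sub>R fourth_difference (mapped_bubble [p2, p1, p4, p3]) a b
      + d 6 *\<^sub>R fourth_difference (mapped_bubble [p2, p4, p3, p1]) a b
      + d 7 *\<^sub>R fourth_difference (mapped_bubble [p3, p1, p2, p4]) a b
      + d 8 *\<^sub>R fourth_difference (mapped_bubble [p3, p4, p1, p2]) a b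
      + d 9 *\<^sub>R fourth_difference (mapped_bubble [p4, p1, p3, p2]) a b = 0"
    if "a \<in> S" "b \<in> S" for a b
    using 0[OF that] unfolding sum9 by (simp add: bubble_orders_def pdefs)
  \<comment> \<open>Coordinates with respect to the three edges at \<open>p1\<close>; below, \<open>rab_k\<close> is the \<open>k\<close>-th
    coordinate of the equation for the edge from \<open>pa\<close> to \<open>pb\<close>.\<close>
  obtain L where L: "linear L" "L \<circ> ref_linear [p1, p2, p3, p4] = id"
    using linear_injective_left_inverse[OF linear_ref_linear inj_ref_linear[OF dist ind]] by blast
  have "L (ref_linear [p1, p2, p3, p4] (axis k 1)) = axis k 1" for k
    using fun_cong[OF L(2)] by simp
  from this[of 1] this[of 2] this[of 3]
  have "L (p2 - p1) = axis 1 1" "L (p3 - p1) = axis 2 1" "L (p4 - p1) = axis 3 1"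
    by (simp_all add: ref_linear_def axis_def)
  \<comment> \<open>The value \<open>L p1\<close> stays unspecified: the equations involve only
    differences of vertices, so it cancels.\<close>
  then have Lp: "L p2 = L p1 + axis 1 1" "L p3 = L p1 + axis 2 1" "L p4 = L p1 + axis 3 1"
    by (simp_all add: linear_diff[OF L(1)] diff_eq_eq add.commute)
  have perms:
    "distinct [p1, p2, p3, p4]" "\<not> affine_dependent {p1, p2, p3, p4}"
    "distinct [p1, p3, p4, p2]" "\<not> affine_dependent {p1, p3, p4, p2}"
    "distinct [p1, p4, p2, p3]" "\<not> affine_dependent {p1, p4, p2, p3}"
    "distinct [p2, p3, p1, p4]" "\<not> affine_dependent {p2, p3, p1, p4}"
    "distinct [p2, p1, p4, p3]" "\<not> affine_dependent {p2, p1, p4, p3}"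
    "distinct [p2, p4, p3, p1]" "\<not> affine_dependent {p2, p4, p3, p1}"
    "distinct [p3, p1, p2, p4]" "\<not> affine_dependent {p3, p1, p2, p4}"
    "distinct [p3, p4, p1, p2]" "\<not> affine_dependent {p3, p4, p1, p2}"
    "distinct [p4, p1, p3, p2]" "\<not> affine_dependent {p4, p1, p3, p2}"
    using dist ind by (auto simp: insert_commute)
  note edges = fourth_difference_mapped_bubble_edges[OF perms(1,2)]
    fourth_difference_mapped_bubble_edges[OF perms(3,4)]
    fourth_difference_mapped_bubble_edges[OF perms(5,6)]
    fourth_difference_mapped_bubble_edges[OF perms(7,8)]
    fourth_difference_mapped_bubble_edges[OF perms(9,10)]
    fourth_difference_mapped_bubble_edges[OF perms(11,12)]
    fourth_difference_mapped_bubble_edges[OF perms(13,14)]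
    fourth_difference_mapped_bubble_edges[OF perms(15,16)]
    fourth_difference_mapped_bubble_edges[OF perms(17,18)]
  \<comment> \<open>An ordering of the vertices may traverse an edge in the opposite direction;
    symmetry of the fourth difference covers this case.\<close>
  note edges' = edges[THEN trans[OF fourth_difference_commute]]
  note eval = linear_add[OF L(1)] linear_diff[OF L(1)] linear_neg[OF L(1)] linear_scale[OF L(1)]
    linear_0[OF L(1)] Lp axis_def
  note eq12 = 1[OF pS(1,2), unfolded edges edges', THEN arg_cong[where f = L]]
  note eq13 = 1[OF pS(1,3), unfolded edges edges', THEN arg_cong[where f = L]]
  note eq14 = 1[OF pS(1,4), unfolded edges edges', THEN arg_cong[where f = L]]
  note eq23 = 1[OF pS(2,3), unfolded edges edges', THEN arg_cong[where f = L]]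
  note eq24 = 1[OF pS(2,4), unfolded edges edges', THEN arg_cong[where f = L]]
  note eq34 = 1[OF pS(3,4), unfolded edges edges', THEN arg_cong[where f = L]]
  \<comment> \<open>Coordinates 1, 2, 3 belong to \<open>p2\<close>, \<open>p3\<close>,
    \<open>p4\<close>. For each edge exactly the coordinates of those among these vertices that lie
    off the edge are kept: two for each edge at \<open>p1\<close>, one for each other edge, nine in
    all.\<close>
  have r12_2: "- 335/12 * d 2 + 7/6 * d 4 - 647/12 * d 7 + 103/3 * d 8 - 247/18 * d 9 = 0"
    using arg_cong[OF eq12, of "\<lambda>x. x $ 2"] by (simp add: eval)
  have r12_3: "7/6 * d 3 - 335/12 * d 6 - 5 * d 7 - 111/4 * d 8 + 1805/36 * d 9 = 0"
    using arg_cong[OF eq12, of "\<lambda>x. x $ 3"] by (simp add: eval)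
  have r13_1: "7/6 * d 1 - 647/12 * d 4 + 1805/36 * d 5 + 103/3 * d 6 - 5 * d 9 = 0"
    using arg_cong[OF eq13, of "\<lambda>x. x $ 1"] by (simp add: eval)
  have r13_3: "- 335/12 * d 3 - 5 * d 4 - 247/18 * d 5 - 111/4 * d 6 + 7/6 * d 8 - 647/12 * d 9 = 0"
    using arg_cong[OF eq13, of "\<lambda>x. x $ 3"] by (simp add: eval)
  have r14_1: "- 335/12 * d 1 + 103/3 * d 4 - 647/12 * d 5 + 1805/36 * d 6 - 247/18 * d 7 - 5 * d 8 = 0"
    using arg_cong[OF eq14, of "\<lambda>x. x $ 1"] by (simp add: eval)
  have r14_2: "7/6 * d 2 - 111/4 * d 4 - 5 * d 5 - 247/18 * d 6 + 1805/36 * d 7 - 647/12 * d 8 = 0"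
    using arg_cong[OF eq14, of "\<lambda>x. x $ 2"] by (simp add: eval)
  have r23_3: "- 5 * d 1 - 247/18 * d 2 - 111/4 * d 3 + 7/6 * d 6 - 335/12 * d 8 + 103/3 * d 9 = 0"
    using arg_cong[OF eq23, of "\<lambda>x. x $ 3"] by (simp add: eval)
  have r24_2: "- 247/18 * d 1 - 111/4 * d 2 - 5 * d 3 - 335/12 * d 4 + 103/3 * d 7 + 1805/36 * d 8 = 0"
    using arg_cong[OF eq24, of "\<lambda>x. x $ 2"] by (simp add: eval)
  have r34_1: "- 111/4 * d 1 - 5 * d 2 - 247/18 * d 3 + 1805/36 * d 4 + 103/3 * d 5 - 647/12 * d 6 = 0"
    using arg_cong[OF eq34, of "\<lambda>x. x $ 1"] by (simp add: eval)
  note zero = edge_system_nonsingular[OF r12_2 r12_3 r13_1 r13_3 r14_1 r14_2 r23_3 r24_2 r34_1]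
  have "i = 1 \<or> i = 2 \<or> i = 3 \<or> i = 4 \<or> i = 5 \<or> i = 6 \<or> i = 7 \<or> i = 8 \<or> i = 9"
    using i unfolding atLeastAtMost_iff by presburger
  then show ?thesis
    by safe (use zero in simp_all)
qed

text \<open>Every entry of \<open>bubble_orders\<close> permutes 1, 2, 3, 4, so each map uses the
  same affinely independent set of vertices.\<close>

lemma bij_ref_map_bubble_orders:
  assumes p: "distinct [p 1, p 2, p 3, p 4]" "\<not> affine_dependent {p 1, p 2, p 3, p 4}"
    and i: "i \<in> {1..9}"
  shows "bij (ref_map (map p (bubble_orders ! (i - 1))))"
proof -
  let ?o = "bubble_orders ! (i - 1)"
  have "\<forall>q\<in>set bubble_orders. length q = 4 \<and> distinct q \<and> set q = {1, 2, 3, 4}"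
    by (simp add: bubble_orders_def) auto
  moreover have "?o \<in> set bubble_orders"
    using i by (intro nth_mem) (auto simp: bubble_orders_def)
  ultimately have o: "length ?o = 4" "distinct ?o" "set ?o = {1, 2, 3, 4}"
    by blast+
  have "inj_on p {1, 2, 3, 4}"
    using p(1) by (auto simp: inj_on_def)
  then have dist: "distinct (map p ?o)"
    using o by (simp add: distinct_map)
  have ind: "\<not> affine_dependent (set (map p ?o))"
    using p(2) o(3) by simp
  obtain q0 q1 q2 q3 where q: "map p ?o = [q0, q1, q2, q3]"
    using o(1) by (auto simp: eval_nat_numeral length_Suc_conv)
  show ?thesis
    using dist ind unfolding q list.set by (rule bij_ref_map)
qed

section \<open>Tetrahedral grids\<close>

lemma finite_lagrange_nodes_of:
  assumes "finite (vertices T)"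
  shows "finite (lagrange_nodes_of T)"
proof -
  let ?f = "\<lambda>m. \<Sum>v\<in>vertices T. (real (m v) / 3) *\<^sub>R v"
  have "lagrange_nodes_of T \<subseteq> ?f ` (vertices T \<rightarrow>\<^sub>E {..3})"
  proof
    fix a assume "a \<in> lagrange_nodes_of T"
    then obtain m :: "real^3 \<Rightarrow> nat" where m: "a = ?f m" "sum m (vertices T) = 3"
      unfolding lagrange_nodes_of_def by blast
    have "m v \<le> 3" if "v \<in> vertices T" for v
      using m(2) member_le_sum[of v "vertices T" m] that assms by simp
    \<comment> \<open>Only the values of \<open>m\<close> at the vertices enter the node; cutting
      \<open>m\<close> off elsewhere leaves finitely many candidates.\<close>
    then have "restrict m (vertices T) \<in> vertices T \<rightarrow>\<^sub>E {..3}"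
      by auto
    moreover have "a = ?f (restrict m (vertices T))"
      by (simp add: m(1))
    ultimately show "a \<in> ?f ` (vertices T \<rightarrow>\<^sub>E {..3})"
      by blast
  qed
  then show ?thesis
    by (rule finite_subset) (use assms in \<open>auto intro!: finite_imageI finite_PiE\<close>)
qed

lemma lagrange_nodes_of_subset:
  assumes "convex T" "finite (vertices T)"
  shows "lagrange_nodes_of T \<subseteq> T"
proof
  fix a assume "a \<in> lagrange_nodes_of T"
  then obtain m :: "real^3 \<Rightarrow> nat" where m: "a = (\<Sum>v\<in>vertices T. (real (m v) / 3) *\<^sub>R v)"
      "sum m (vertices T) = 3"
    unfolding lagrange_nodes_of_def by blast
  have "(\<Sum>v\<in>vertices T. real (m v) / 3) = 1"
    using m(2) by (simp flip: sum_divide_distrib of_nat_sum)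
  then show "a \<in> T"
    unfolding m(1) using assms by (intro convex_sum) (auto simp: vertices_def extreme_point_of_def)
qed

lemma tetrahedron_vertices:
  assumes "3 simplex T"
  shows "finite (vertices T)" "\<not> affine_dependent (vertices T)" "T = convex hull (vertices T)"
proof -
  obtain C where C: "finite C" "\<not> affine_dependent C" "T = convex hull C"
    using assms by (auto simp: simplex)
  then have "vertices T = C"
    by (auto simp: vertices_def extreme_point_of_convex_hull_affine_independent)
  then show "finite (vertices T)" "\<not> affine_dependent (vertices T)" "T = convex hull (vertices T)"
    using C by auto
qed

text \<open>A 3-simplex has full affine dimension, so its interior is its relative interior, which
  is nonempty for a nonempty convex set.\<close>

lemma interior_tetrahedron_nonempty:
  fixes T :: "(real^3) set"
  assumes "3 simplex T"
  shows "interior T \<noteq> {}"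
proof -
  have "affine hull T = UNIV"
    using aff_dim_simplex[OF assms] by (simp flip: aff_dim_eq_full)
  then have "interior T = rel_interior T"
    by (simp add: rel_interior_interior)
  moreover have "T \<noteq> {}"
    using aff_dim_simplex[OF assms] by auto
  ultimately show ?thesis
    using convex_simplex[OF assms] by (simp add: rel_interior_eq_empty)
qed

text \<open>A common face meeting the interior of \<open>T\<close> is all of \<open>T\<close>; then
  \<open>T\<close> would be a proper face of \<open>T'\<close> and have smaller dimension.\<close>

lemma interior_Int_triangulation:
  fixes \<T> :: "(real^3) set set"
  assumes "triangulation \<T>" "T \<in> \<T>" "T' \<in> \<T>" "3 simplex T" "3 simplex T'" "T \<noteq> T'"
  shows "interior T \<inter> T' = {}"
proof (rule ccontr)
  assume "interior T \<inter> T' \<noteq> {}"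
  then have "(T \<inter> T') \<inter> interior T \<noteq> {}"
    using interior_subset by blast
  moreover have face: "T \<inter> T' face_of T" "T \<inter> T' face_of T'"
    using assms(1-3) unfolding triangulation_def by (blast, metis Int_commute)
  ultimately have "T \<inter> T' = T"
    using face_of_disjoint_interior by blast
  then have "aff_dim T < aff_dim T'"
    using face face_of_aff_dim_lt[of T' T] assms convex_simplex by auto
  then show False
    using aff_dim_simplex[OF assms(4)] aff_dim_simplex[OF assms(5)] by simp
qed

section \<open>Discrete fields restricted to a single tetrahedron\<close>

lemma bubble_eq_mapped_bubble:
  "bubble p T i x = (if x \<in> T then mapped_bubble (map (p T) (bubble_orders ! (i - 1))) x else 0)"
  by (simp add: bubble_def Let_def jacobian_ref_map mapped_bubble_def)

lemma conforming_part_component: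
  "conforming_part \<T> \<phi> c x $ k = (\<Sum>a\<in>lagrange_nodes \<T>. c a k * \<phi> a x)"
proof -
  have "(\<Sum>k'\<in>UNIV. c a k' *\<^sub>R vector_lagrange \<phi> a k' x) $ k = c a k * \<phi> a x" for a
    by (simp add: vector_lagrange_def axis_def if_distrib cong: if_cong)
  then show ?thesis
    by (simp add: conforming_part_def)
qed

lemma vertex_ordering_tetrahedron:
  assumes "vertex_ordering \<T> p" "T \<in> \<T>" "3 simplex T"
  shows "distinct [p T 1, p T 2, p T 3, p T 4]"
    "\<not> affine_dependent {p T 1, p T 2, p T 3, p T 4}" "{p T 1, p T 2, p T 3, p T 4} \<subseteq> T"
proof -
  have bij: "bij_betw (p T) {1..4} (vertices T)"
    using assms by (simp add: vertex_ordering_def)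
  have 4: "{1..4} = {1, 2, 3, 4::nat}"
    by auto
  show "distinct [p T 1, p T 2, p T 3, p T 4]"
    using bij_betw_imp_inj_on[OF bij] unfolding 4 by (auto simp: inj_on_def)
  have "vertices T = {p T 1, p T 2, p T 3, p T 4}"
    using bij_betw_imp_surj_on[OF bij] unfolding 4 by simp
  moreover have "vertices T \<subseteq> T"
    by (auto simp: vertices_def extreme_point_of_def)
  ultimately show "\<not> affine_dependent {p T 1, p T 2, p T 3, p T 4}" "{p T 1, p T 2, p T 3, p T 4} \<subseteq> T"
    using tetrahedron_vertices(2)[OF assms(3)] by simp_all
qed

lemma conforming_part_extend:
  assumes "scalar_lagrange_basis \<T> \<phi>" "T \<in> \<T>"
  obtains P where "polynomial_function P" "\<And>x. x \<in> T \<Longrightarrow> conforming_part \<T> \<phi> c x = P x"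
    "\<And>a b. fourth_difference P a b = 0"
proof -
  have "polynomial_of_degree_on 3 T (\<lambda>x. conforming_part \<T> \<phi> c x $ k)" for k
    unfolding conforming_part_component using assms
    by (intro polynomial_of_degree_on_sum polynomial_of_degree_on_cmult)
       (simp add: scalar_lagrange_basis_def)
  then have "\<forall>k. \<exists>g. real_polynomial_function g \<and> (\<forall>x\<in>T. conforming_part \<T> \<phi> c x $ k = g x) \<and>
      (\<forall>a b. fourth_difference g a b = 0)"
    by (intro allI) (rule cubic_on_extend, assumption, blast)
  then obtain g where g: "\<forall>k. real_polynomial_function (g k) \<and>
      (\<forall>x\<in>T. conforming_part \<T> \<phi> c x $ k = g k x) \<and> (\<forall>a b. fourth_difference (g k) a b = 0)"
    by (rule choice[THEN exE])
  show ?thesis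
  proof (rule that[of "\<lambda>x. \<chi> k. g k x"])
    show "polynomial_function (\<lambda>x. \<chi> k. g k x)"
      by (rule polynomial_function_componentI) (simp add: g)
    show "fourth_difference (\<lambda>x. \<chi> k. g k x) a b = 0" for a b
      by (simp add: vec_eq_iff fourth_difference_component g)
  qed (simp add: vec_eq_iff g)
qed

lemma broken_grad_form_eq_0D:
  assumes "finite \<T>" "broken_grad_form \<T> v v = 0" "T \<in> \<T>"
  shows "(LINT x:interior T|lborel. jacobian v (at x) \<bullet> jacobian v (at x)) = 0"
proof -
  \<comment> \<open>This holds even for a non-integrable density, whose integral is 0 by convention;
    a vanishing sum of such terms vanishes termwise.\<close>
  have "(LINT x:interior T|lborel. jacobian v (at x) \<bullet> jacobian v (at x)) \<ge> 0" for T
    unfolding set_lebesgue_integral_def by (intro integral_nonneg_AE) auto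
  then show ?thesis
    using assms by (simp add: broken_grad_form_def sum_nonneg_eq_0_iff)
qed

section \<open>From single tetrahedra to the whole grid\<close>

theorem lemma2p1:
  fixes \<Omega> :: "(real^3) set"
    and H :: "real set"
    and \<T> :: "real \<Rightarrow> (real^3) set set"
    and h :: real
    and p :: "(real^3) set \<Rightarrow> nat \<Rightarrow> real^3"
    and \<phi> :: "real^3 \<Rightarrow> real^3 \<Rightarrow> real"
    and c :: "real^3 \<Rightarrow> 3 \<Rightarrow> real"
    and d :: "(real^3) set \<Rightarrow> nat \<Rightarrow> real"
    and v :: "real^3 \<Rightarrow> real^3"
  assumes "polyhedral_domain \<Omega>"
    and "quasiuniform_family \<Omega> H \<T>"
    and "h \<in> H"
    and "vertex_ordering (\<T> h) p"
    and "scalar_lagrange_basis (\<T> h) \<phi>"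
    and "\<And>x. v x = conforming_part (\<T> h) \<phi> c x + bubble_part (\<T> h) p d x"
    and "\<And>x. x \<in> frontier \<Omega> \<Longrightarrow> conforming_part (\<T> h) \<phi> c x = 0"
    and "broken_grad_form (\<T> h) v v = 0"
  shows "(\<forall>a\<in>lagrange_nodes (\<T> h). \<forall>k. c a k = 0) \<and>
         (\<forall>T\<in>\<T> h. \<forall>i\<in>{1..9}. d T i = 0)"
proof -
  let ?N = "lagrange_nodes (\<T> h)" and ?vc = "conforming_part (\<T> h) \<phi> c"
  have tri: "triangulation (\<T> h)" and simplex: "\<And>T. T \<in> \<T> h \<Longrightarrow> 3 simplex T"
    and cover: "\<Union>(\<T> h) = closure \<Omega>"
    using assms(2,3) by (auto simp: quasiuniform_family_def tetrahedral_grid_def)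
  then have fin: "finite (\<T> h)"
    by (simp add: triangulation_def)
  have \<Omega>: "connected \<Omega>" "bounded \<Omega>" "\<Omega> \<noteq> {}"
    using assms(1) by (auto simp: polyhedral_domain_def)

  have local: "(\<forall>i\<in>{1..9}. d T i = 0) \<and> (\<exists>C. \<forall>x\<in>T. ?vc x = C)" if T: "T \<in> \<T> h" for T
  proof -
    note p = vertex_ordering_tetrahedron[OF assms(4) T simplex[OF T]]
    let ?b = "\<lambda>i. mapped_bubble (map (p T) (bubble_orders ! (i - 1)))"
    obtain P where P: "polynomial_function P" "\<And>x. x \<in> T \<Longrightarrow> ?vc x = P x"
        "\<And>a b. fourth_difference P a b = 0"
      using conforming_part_extend[OF assms(5) T, of c] by blast
    \<comment> \<open>\<open>W\<close> continues \<open>v\<close> polynomially from the interior of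
      \<open>T\<close>. On a shared face \<open>v\<close> itself may differ from \<open>W\<close>,
      since bubbles of both neighbours are added there.\<close>
    define W where "W = (\<lambda>x. P x + (\<Sum>i=1..9. d T i *\<^sub>R ?b i x))"
    have W: "polynomial_function W"
      unfolding W_def using p
      by (intro polynomial_function_add polynomial_function_sum polynomial_function_cmul P
          polynomial_function_mapped_bubble bij_ref_map_bubble_orders) auto
    have v: "v x = W x" if x: "x \<in> interior T" for x
    proof -
      have "x \<in> T"
        using x interior_subset by blast
      \<comment> \<open>The zero extension removes the bubbles of every other tetrahedron at an
        interior point of \<open>T\<close>.\<close>
      have "x \<notin> T'" if "T' \<in> \<T> h" "T' \<noteq> T" for T'
        using interior_Int_triangulation[OF tri T that(1)] simplex T that x by blast
      then have "(\<Sum>i=1..9. d T' i *\<^sub>R bubble p T' i x) =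
          (if T' = T then \<Sum>i=1..9. d T i *\<^sub>R ?b i x else 0)" if "T' \<in> \<T> h" for T'
        using that \<open>x \<in> T\<close> by (simp add: bubble_eq_mapped_bubble)
      then have "bubble_part (\<T> h) p d x = (\<Sum>i=1..9. d T i *\<^sub>R ?b i x)"
        using T fin by (simp add: bubble_part_def)
      then show ?thesis
        using P \<open>x \<in> T\<close> by (simp add: assms(6) W_def)
    qed
    have "jacobian v (at x) = jacobian W (at x)" if "x \<in> interior T" for x
      using that v W by (intro jacobian_cong_open[of "interior T"] differentiable_at_polynomial_function) auto
    then have "(LINT x:interior T|lborel. jacobian W (at x) \<bullet> jacobian W (at x)) =
        (LINT x:interior T|lborel. jacobian v (at x) \<bullet> jacobian v (at x))"
      by (intro set_lebesgue_integral_cong) auto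
    also have "\<dots> = 0"
      using broken_grad_form_eq_0D[OF fin assms(8) T] .
    finally obtain C where C: "\<And>x. x \<in> T \<Longrightarrow> W x = C"
      using polynomial_constant_if_energy_0[OF W convex_simplex[OF simplex[OF T]]
          compact_simplex[OF simplex[OF T]] interior_tetrahedron_nonempty[OF simplex[OF T]]] by blast
    have d: "d T i = 0" if "i \<in> {1..9}" for i
    proof (rule mapped_bubbles_independent_mod_cubics[OF p(1,2)])
      show "convex T"
        using simplex[OF T] by (rule convex_simplex)
      show "fourth_difference P a b = 0" for a b
        by (rule P)
      show "P x + (\<Sum>i=1..9. d T i *\<^sub>R ?b i x) = C" if "x \<in> T" for x
        using C[OF that] by (simp add: W_def)
    qed (use p(3) that in auto)
    then have "?vc x = C" if "x \<in> T" for x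
      using C[OF that] P(2)[OF that] by (simp add: W_def)
    with d show ?thesis
      by blast
  qed

  have node: "finite (lagrange_nodes_of T)" "lagrange_nodes_of T \<subseteq> T" if "T \<in> \<T> h" for T
    using tetrahedron_vertices(1)[OF simplex[OF that]] convex_simplex[OF simplex[OF that]]
    by (simp_all add: finite_lagrange_nodes_of lagrange_nodes_of_subset)
  then have N: "finite ?N" "?N \<subseteq> closure \<Omega>"
    using fin by (auto simp: lagrange_nodes_def simp flip: cover)

  \<comment> \<open>In the connected space only the empty set and the whole space have empty
    frontier; a nonempty bounded domain is neither.\<close>
  obtain z where z: "z \<in> frontier \<Omega>"
    using \<Omega> frontier_eq_empty[of \<Omega>] not_bounded_UNIV by blast
  \<comment> \<open>Each component takes one value per tetrahedron, hence finitely many. A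
    continuous function of finite range on a connected set is constant, and its value at
    \<open>z\<close> is 0.\<close>
  have "?vc x $ k = 0" if x: "x \<in> closure \<Omega>" for x k
  proof -
    have "(\<lambda>x. ?vc x $ k) ` closure \<Omega> = (\<Union>T\<in>\<T> h. (\<lambda>x. ?vc x $ k) ` T)"
      by (auto simp flip: cover)
    moreover have "finite ((\<lambda>x. ?vc x $ k) ` T)" if T: "T \<in> \<T> h" for T
    proof -
      obtain C where "\<forall>x\<in>T. ?vc x = C"
        using local[OF T] by blast
      then have "(\<lambda>x. ?vc x $ k) ` T \<subseteq> {C $ k}"
        by auto
      then show ?thesis
        by (rule finite_subset) simp
    qed
    ultimately have "finite ((\<lambda>x. ?vc x $ k) ` closure \<Omega>)"
      using fin by simp
    moreover have "continuous_on (closure \<Omega>) (\<lambda>x. ?vc x $ k)"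
      unfolding conforming_part_component using assms(5) cover
      by (intro continuous_intros) (simp add: scalar_lagrange_basis_def)
    ultimately have "(\<lambda>x. ?vc x $ k) constant_on closure \<Omega>"
      using \<Omega> by (intro continuous_finite_range_constant connected_imp_connected_closure)
    moreover have "z \<in> closure \<Omega>" "?vc z $ k = 0"
      using z assms(7)[OF z] by (auto simp: frontier_def)
    ultimately show ?thesis
      using x unfolding constant_on_def by force
  qed
  \<comment> \<open>At a node all other basis functions vanish, so the nodal value is the
    coefficient.\<close>
  moreover have "?vc a $ k = c a k" if a: "a \<in> ?N" for a k
  proof -
    have "\<phi> b a = (if a = b then 1 else 0)" if "b \<in> ?N" for b
      using assms(5) a that by (auto simp: scalar_lagrange_basis_def)
    then have "?vc a $ k = (\<Sum>b\<in>?N. c b k * (if a = b then 1 else 0))"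
      by (simp add: conforming_part_component)
    then show ?thesis
      using a N(1) by (simp add: if_distrib cong: if_cong)
  qed
  ultimately show ?thesis
    using N(2) local by fastforce
qed

end
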